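(* Let $\upsilon\ge1$ be an integer, $q>-1$, and $s\ge 0$ an integer with $s<\frac{p-1}{2}$. Write $N_s^{(p,q)}={}_KN_{s;\upsilon}^{(p,q)}(t,w)$ for the first set of finite bivariate biorthogonal N-Konhauser polynomials, and $D_t=\partial/\partial t$, $D_w=\partial/\partial w$. These polynomials have the following recurrence relations ($m$ a non-negative integer). Items 1 to 10 hold for $s\ge0$: 1. $tD_tN_s^{(p,q)}=s\left(N_s^{(p,q)}+N_{s-1}^{(p-1,q)}\right)$. 2. $D_tN_s^{(p,q)}=s(s+1-p)\,w^{\upsilon}N_{s-1}^{(p-2,q+\upsilon)}-s(s-1)N_{s-2}^{(p-2,q)}+s(p-2s)N_{s-1}^{(p-1,q)}$. 3. $D_t^m\!\left(t^{s-p+m}N_s^{(p,q)}\right)=\dfrac{(-1)^m\Gamma(p-s)}{\Gamma(p-m-s)}\,t^{s-p}N_s^{(p-m,q)}$, $0\le m\le p-2s-1$. 4. $D_w^m\!\left(w^qN_s^{(p,q)}\right)=w^{q-m}N_s^{(p,q-m)}$, $0\le m\le q$. 5. $D_t^{-m}\!\left(t^{s-p-m}N_s^{(p,q)}\right)=\dfrac{(-1)^m\Gamma(p-s)}{\Gamma(p-s+m)}\,t^{s-p}N_s^{(p+m,q)}$. 6. $D_w^{-m}\!\left(w^qN_s^{(p,q)}\right)=w^{q+m}N_s^{(p,q+m)}$. 7. $D_w^{\upsilon}\!\left(w^{q+1}D_wN_s^{(p,q)}\right)=-s\upsilon(p-s-1)\,t\,w^qN_{s-1}^{(p-2,q)}$.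 8. $D_w^{\upsilon}\!\left(w^{q+1}D_wN_s^{(p,q)}\right)=w^{q+1}D_wN_s^{(p,q)}-s\upsilon w^q\left(N_s^{(p,q)}+N_{s-1}^{(p-1,q)}\right)$. 9. $wD_wN_s^{(p,q)}=s\upsilon\left(N_s^{(p,q)}+N_{s-1}^{(p-1,q)}-(p-s-1)\,t\,N_{s-1}^{(p-2,q)}\right)$. 10. $D_wN_s^{(p,q)}=-s\upsilon(p-s-1)\,t\,w^{\upsilon-1}N_{s-1}^{(p-2,q+\upsilon)}$. Moreover: 11. For $s\ge2$: $N_s^{(p,q)}+(s-1)\,t\,N_{s-2}^{(p-2,q)}=\big((p-2s)t-1\big)N_{s-1}^{(p-1,q)}-(p-s-1)\,t\,w^{\upsilon}N_{s-1}^{(p-2,q+\upsilon)}$. 12. For $s\ge1$: $(p-s-1)\,t\left(N_{s-1}^{(p-2,q)}-w^{\upsilon}N_{s-1}^{(p-2,q+\upsilon)}\right)=N_s^{(p,q)}+N_{s-1}^{(p-1,q)}$. Here $D_t^{-1}f(t)=\int_0^t f(x)\,dx$.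
   Context: $(a)_n$ is the Pochhammer symbol and $\Gamma$ the Gamma function. For $\upsilon=1,2,\dots$, the first set of finite bivariate biorthogonal N-Konhauser polynomials is defined by $${}_KN_{s;\upsilon}^{(p,q)}(t,w)=\Gamma(p-s)\sum_{k=0}^{s}\sum_{m=0}^{s-k}\frac{(-s)_{k+m}\,t^{s-k}w^{\upsilon m}}{\Gamma(p-2s+k)\,\Gamma(q+1+\upsilon m)\,k!\,m!},$$ where $q>-1$ and $s=0,1,\dots,S<\frac{p-1}{2}$. Likewise $D_w^{-1}f(w)=\int_0^w f(x)\,dx$, and $D_t^{-m}$, $D_w^{-m}$ denote the $m$-fold iterates of $D_t^{-1}$, $D_w^{-1}$. Terms with a polynomial of negative index $s-1$ or $s-2$ are understood to be $0$ when their numerical factor ($s$ or $s(s-1)$) vanishes.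
   Formalization: In item 5 the integral from 0 to t diverges for every m ≥ 1 (e.g. s=0, p=2, m=1 gives the integral of x^(-3)), so there D_t^{-1} is read as Hadamard's finite part of that integral, which equals the ordinary integral whenever the latter exists. *)

theory Defs
  imports "HOL-Analysis.Analysis" "HOL-Real_Asymp.Real_Asymp"
begin

(* The index s is a natural number.  Polynomials of index s - 1 and s - 2 are used only when these
   are nonnegative or when a factor s resp. s (s - 1) makes the term 0, so truncated subtraction
   is harmless. *)
definition N_Konhauser :: "nat \<Rightarrow> nat \<Rightarrow> real \<Rightarrow> real \<Rightarrow> real \<Rightarrow> real \<Rightarrow> real" where
  "N_Konhauser \<upsilon> s p q t w =
     Gamma (p - real s) *
     (\<Sum>k=0..s. \<Sum>m=0..s-k.
        pochhammer (- real s) (k + m) * t ^ (s - k) * w ^ (\<upsilon> * m) /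
        (Gamma (p - 2 * real s + real k) * Gamma (q + 1 + real \<upsilon> * real m) * fact k * fact m))"

definition integral_from_0 :: "(real \<Rightarrow> real) \<Rightarrow> real \<Rightarrow> real" where
  "integral_from_0 f x = integral {0..x} f"

(* Hadamard's finite part of the integral of f from 0 to x, for f possibly singular at 0: the
   constant term left over when the negative powers of e and the logarithm are removed from the
   integral over [e, x] as e tends to 0 from the right.  The lemmas after the definition
   show that it is unique and that it equals the ordinary integral whenever the latter exists.
   This is how the operator D_t^(-1) = "integral from 0 to t" is read: it is applied to combinations
   of powers t^a with a < -1 only, for which the ordinary integral from 0 diverges. *)
definition has_finite_part_integral :: "(real \<Rightarrow> real) \<Rightarrow> real \<Rightarrow> real \<Rightarrow> bool" where
  "has_finite_part_integral f x L \<longleftrightarrow>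
     (\<forall>e\<in>{0<..x}. f integrable_on {e..x}) \<and>
     (\<exists>(A :: real set) (c :: real \<Rightarrow> real) (b :: real). finite A \<and> A \<subseteq> {0<..} \<and>
        ((\<lambda>e. integral {e..x} f - (\<Sum>a\<in>A. c a * e powr (- a)) - b * ln e) \<longlongrightarrow> L) (at_right 0))"

definition finite_part_integral_from_0 :: "(real \<Rightarrow> real) \<Rightarrow> real \<Rightarrow> real" where
  "finite_part_integral_from_0 f x = (THE L. has_finite_part_integral f x L)"

lemma singular_part_limit_eq_0:
  fixes A :: "real set" and c :: "real \<Rightarrow> real" and b L :: real
  assumes "finite A" "A \<subseteq> {0<..}"
    and lim: "((\<lambda>e. (\<Sum>a\<in>A. c a * e powr (- a)) + b * ln e) \<longlongrightarrow> L) (at_right 0)"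
  shows "L = 0"
proof -
  define B where "B = {a \<in> A. c a \<noteq> 0}"
  have B: "finite B" "B \<subseteq> {0<..}" using assms by (auto simp: B_def)
  have "(\<Sum>a\<in>A. c a * e powr (- a)) = (\<Sum>a\<in>B. c a * e powr (- a))" for e
    unfolding B_def by (rule sum.mono_neutral_right) (use assms in auto)
  with lim have lim': "((\<lambda>e. (\<Sum>a\<in>B. c a * e powr (- a)) + b * ln e) \<longlongrightarrow> L) (at_right 0)"
    by simp
  have ev: "eventually (\<lambda>e::real. 0 < e \<and> e < 1) (at_right 0)"
    by (auto simp: eventually_at_right_field intro: exI[of _ 1])
  have powr0: "((\<lambda>e. e powr r) \<longlongrightarrow> 0) (at_right (0::real))" if "r > 0" for r :: real
    using that by real_asymp
  have B_empty: "B = {}"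
  proof (rule ccontr)
    assume ne: "B \<noteq> {}"
    define M where "M = Max B"
    have M: "M \<in> B" "\<And>a. a \<in> B \<Longrightarrow> a \<le> M"
      using B ne by (simp_all add: M_def)
    with B have M_pos: "M > 0" by auto
    have ln0: "((\<lambda>e. e powr M * ln e) \<longlongrightarrow> 0) (at_right (0::real))"
      using M_pos by real_asymp
    have "((\<lambda>e. e powr M * ((\<Sum>a\<in>B. c a * e powr (- a)) + b * ln e)) \<longlongrightarrow> 0 * L) (at_right 0)"
      by (intro tendsto_mult powr0 lim' M_pos)
    moreover have lim2: "((\<lambda>e. (\<Sum>a\<in>B. c a * (if a = M then 1 else e powr (M - a))) + b * (e powr M * ln e))
        \<longlongrightarrow> (\<Sum>a\<in>B. c a * (if a = M then 1 else 0)) + b * 0) (at_right 0)"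
    proof (intro tendsto_add tendsto_sum tendsto_mult tendsto_const ln0)
      fix a assume "a \<in> B"
      then have "a \<le> M" by (rule M)
      then show "((\<lambda>e. if a = M then 1 else e powr (M - a)) \<longlongrightarrow> (if a = M then 1 else 0)) (at_right 0)"
        using powr0[of "M - a"] by (cases "a = M") auto
    qed
    moreover have "eventually (\<lambda>e. e powr M * ((\<Sum>a\<in>B. c a * e powr (- a)) + b * ln e) =
        (\<Sum>a\<in>B. c a * (if a = M then 1 else e powr (M - a))) + b * (e powr M * ln e)) (at_right 0)"
      using ev
    proof eventually_elim
      case (elim e)
      have "e powr M * (c a * e powr (- a)) = c a * (if a = M then 1 else e powr (M - a))" for a
        using elim powr_add[of e M "- a"] by auto
      then show ?case
        by (simp only: distrib_left sum_distrib_left mult.left_commute[of _ b])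
    qed
    ultimately have "(\<Sum>a\<in>B. c a * (if a = M then 1 else 0)) + b * 0 = 0 * L"
      by (intro tendsto_unique[OF trivial_limit_at_right_real lim2]) (rule Lim_transform_eventually)
    moreover have "(\<Sum>a\<in>B. c a * (if a = M then 1 else 0)) = (\<Sum>a\<in>B. if a = M then c a else 0)"
      by (rule sum.cong) auto
    ultimately have "c M = 0" using M(1) B(1) by simp
    with M(1) show False by (simp add: B_def)
  qed
  then have lim'': "((\<lambda>e. b * ln e) \<longlongrightarrow> L) (at_right 0)" using lim' by simp
  have inv0: "((\<lambda>e. 1 / ln e) \<longlongrightarrow> 0) (at_right (0::real))" by real_asymp
  have "((\<lambda>e. 1 / ln e * (b * ln e)) \<longlongrightarrow> 0 * L) (at_right 0)"
    by (intro tendsto_mult inv0 lim'')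
  moreover have "eventually (\<lambda>e. 1 / ln e * (b * ln e) = b) (at_right 0)"
    using ev by eventually_elim auto
  ultimately have "((\<lambda>e::real. b) \<longlongrightarrow> 0) (at_right 0)"
    by (simp add: tendsto_cong)
  then have "b = 0" by (simp add: tendsto_const_iff)
  then show "L = 0" using lim'' by (simp add: tendsto_const_iff)
qed

lemma has_finite_part_integral_unique:
  assumes "has_finite_part_integral f x L" "has_finite_part_integral f x L'"
  shows "L = L'"
proof -
  obtain A c b where 1: "finite A" "A \<subseteq> {0<..}"
    "((\<lambda>e. integral {e..x} f - (\<Sum>a\<in>A. c a * e powr (- a)) - b * ln e) \<longlongrightarrow> L) (at_right 0)"
    using assms(1) unfolding has_finite_part_integral_def by blast
  obtain A' c' b' where 2: "finite A'" "A' \<subseteq> {0<..}"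
    "((\<lambda>e. integral {e..x} f - (\<Sum>a\<in>A'. c' a * e powr (- a)) - b' * ln e) \<longlongrightarrow> L') (at_right 0)"
    using assms(2) unfolding has_finite_part_integral_def by blast
  define C where "C a = (if a \<in> A' then c' a else 0) - (if a \<in> A then c a else 0)" for a
  have s1: "(\<Sum>a\<in>A. c a * e powr (- a)) = (\<Sum>a\<in>A\<union>A'. (if a \<in> A then c a else 0) * e powr (- a))" for e
    by (rule sum.mono_neutral_cong_left) (use 1 2 in auto)
  have s2: "(\<Sum>a\<in>A'. c' a * e powr (- a)) = (\<Sum>a\<in>A\<union>A'. (if a \<in> A' then c' a else 0) * e powr (- a))" for e
    by (rule sum.mono_neutral_cong_left) (use 1 2 in auto)
  have "((\<lambda>e. (\<Sum>a\<in>A\<union>A'. C a * e powr (- a)) + (b' - b) * ln e) \<longlongrightarrow> L - L') (at_right 0)"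
    using tendsto_diff[OF 1(3) 2(3)]
    by (simp add: s1 s2 C_def left_diff_distrib sum_subtractf algebra_simps)
  then have "L - L' = 0"
    by (rule singular_part_limit_eq_0[rotated 2]) (use 1 2 in auto)
  then show ?thesis by simp
qed

lemma finite_part_integral_from_0_eqI:
  "has_finite_part_integral f x L \<Longrightarrow> finite_part_integral_from_0 f x = L"
  unfolding finite_part_integral_from_0_def
  by (blast intro: the_equality has_finite_part_integral_unique)

lemma finite_part_integral_eq_integral:
  assumes "f integrable_on {0..x}" "x > 0"
  shows "has_finite_part_integral f x (integral {0..x} f)"
    and "finite_part_integral_from_0 f x = integral_from_0 f x"
proof -
  have "continuous_on {0..x} (\<lambda>e. integral {e..x} f)"
    by (rule indefinite_integral_continuous_1'[OF assms(1)])
  then have "((\<lambda>e. integral {e..x} f) \<longlongrightarrow> integral {0..x} f) (at 0 within {0..x})"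
    using assms(2) by (auto simp: continuous_on_def)
  then have lim: "((\<lambda>e. integral {e..x} f) \<longlongrightarrow> integral {0..x} f) (at_right 0)"
    using assms(2) by (simp add: at_within_Icc_at_right)
  have "f integrable_on {e..x}" if "e \<in> {0<..x}" for e
    by (rule integrable_on_subinterval[OF assms(1)]) (use that in auto)
  with lim show *: "has_finite_part_integral f x (integral {0..x} f)"
    unfolding has_finite_part_integral_def
    by (intro conjI ballI exI[of _ "{}"] exI[of _ "\<lambda>_. 0"] exI[of _ 0]) auto
  show "finite_part_integral_from_0 f x = integral_from_0 f x"
    using finite_part_integral_from_0_eqI[OF *] by (simp add: integral_from_0_def)
qed

end

theory Submission
  imports Defs
begin

text \<open>
  Write $c_{k,m}$ for the coefficient of $t^{s-k} w^{\upsilon m}$ in $N_s^{(p,q)}$. Lowering $s$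
  together with $p$, and possibly raising $q$ by $\upsilon$, only multiplies $c_{k,m}$ by a rational
  function of $k$ and $m$, after a shift of summation index; this is the functional equation of the
  Gamma function together with $(-s)_{j+1} = -s\,(1-s)_j = (j-s)\,(-s)_j$. With the notation
  $W(a) = \sum_{k,m} a(k,m)\, c_{k,m}\, t^{s-k} w^{\upsilon m}$ one finds
  \<^item> $s N_{s-1}^{(p-1,q)} = W(-k)$,
  \<^item> $s t N_{s-1}^{(p-1,q)} = W\left(\frac{s-k-m}{p-2s+k}\right)$,
  \<^item> $s (p-s-1) t N_{s-1}^{(p-2,q)} = W(s-k-m)$,
  \<^item> $s (p-s-1) t w^\upsilon N_{s-1}^{(p-2,q+\upsilon)} = W(-m)$,
  \<^item> $s (s-1) t N_{s-2}^{(p-2,q)} = W\left(-k\,\frac{s-k-m}{p-2s+k}\right)$,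

  and the Euler operators act diagonally: $t D_t N = W(s-k)$ and $w D_w N = \upsilon W(m)$. So each
  relation with at most one derivative becomes an identity between weights, possibly after
  multiplication by $s$ and by $t$ or $w$. Dividing by $t$ or $w$ is harmless, also where that
  variable vanishes, since both sides are continuous.

  The iterated operators rest on two one-step rules for powers. In $w$ it is
  $D_w (w^q N^{(p,q)}) = w^{q-1} N^{(p,q-1)}$ for $q > 0$
  (\<open>powr_N_has_derivative_w\<close>), which iterates directly and, read backwards, gives the integral. Since
  $w^{q+1} D_w N^{(p,q)}$ is a multiple of $w^{q+\upsilon} N_{s-1}^{(p-2,q+\upsilon)}$, the operator
  $D_w^\upsilon w^{q+1} D_w$ is covered as well. In $t$ the intermediate functions are not
  N-Konhauser polynomials times a power; they are of the form
  $h_x(t) = \sum_k a_k \Gamma(x+k) t^{-x-k}$ with fixed $a_k$. They satisfy $h_x' = -h_{x+1}$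
  (\<open>Gamma_powr_sum_has_derivative\<close>), and for $x > 0$ the finite part of
  $\int_0^t h_{x+1}$ is $-h_x(t)$, because $h_x(e)$ consists of negative powers of $e$ only
  (\<open>Gamma_powr_sum_finite_part_integral\<close>). The two $t$-formulas are the $m$-fold passage between
  $h_{p-m-2s}$ and $h_{p-2s}$ in either direction, for one choice of $a_k$.
\<close>

section \<open>Weighted sums over the terms of an N-Konhauser polynomial\<close>

definition N_coeff :: "nat \<Rightarrow> nat \<Rightarrow> real \<Rightarrow> real \<Rightarrow> nat \<Rightarrow> nat \<Rightarrow> real" where
  "N_coeff \<upsilon> s p q k m =
     Gamma (p - real s) * pochhammer (- real s) (k + m) /
     (Gamma (p - 2 * real s + real k) * Gamma (q + 1 + real \<upsilon> * real m) * fact k * fact m)"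

text \<open>
  The full square $k, m \le s$ replaces the triangle $k + m \le s$: the coefficients vanish
  outside the triangle, and shifts of $k$ and of $m$ become independent of each other.
\<close>

definition N_weighted ::
  "(nat \<Rightarrow> nat \<Rightarrow> real) \<Rightarrow> nat \<Rightarrow> nat \<Rightarrow> real \<Rightarrow> real \<Rightarrow> real \<Rightarrow> real \<Rightarrow> real" where
  "N_weighted a \<upsilon> s p q t w =
     (\<Sum>k\<le>s. \<Sum>m\<le>s. a k m * (N_coeff \<upsilon> s p q k m * t ^ (s - k) * w ^ (\<upsilon> * m)))"

lemma N_coeff_eq_0: "s < k + m \<Longrightarrow> N_coeff \<upsilon> s p q k m = 0"
  by (simp add: N_coeff_def pochhammer_of_nat_eq_0_lemma)

lemma N_Konhauser_eq_sum:
  "N_Konhauser \<upsilon> s p q t w = (\<Sum>k\<le>s. \<Sum>m\<le>s. N_coeff \<upsilon> s p q k m * t ^ (s - k) * w ^ (\<upsilon> * m))"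
proof -
  have "N_Konhauser \<upsilon> s p q t w =
      (\<Sum>k\<le>s. \<Sum>m\<le>s-k. N_coeff \<upsilon> s p q k m * t ^ (s - k) * w ^ (\<upsilon> * m))"
    by (simp add: N_Konhauser_def N_coeff_def sum_distrib_left atLeast0AtMost mult_ac)
  also have "\<dots> = (\<Sum>k\<le>s. \<Sum>m\<le>s. N_coeff \<upsilon> s p q k m * t ^ (s - k) * w ^ (\<upsilon> * m))"
    by (intro sum.cong sum.mono_neutral_left) (auto intro!: N_coeff_eq_0)
  finally show ?thesis .
qed

lemma N_Konhauser_eq_weighted: "N_Konhauser \<upsilon> s p q t w = N_weighted (\<lambda>k m. 1) \<upsilon> s p q t w"
  by (simp add: N_Konhauser_eq_sum N_weighted_def)

lemma N_weighted_add:
  "N_weighted a \<upsilon> s p q t w + N_weighted b \<upsilon> s p q t w = N_weighted (\<lambda>k m. a k m + b k m) \<upsilon> s p q t w"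
  by (simp add: N_weighted_def sum.distrib distrib_right)

lemma N_weighted_cmult:
  "c * N_weighted a \<upsilon> s p q t w = N_weighted (\<lambda>k m. c * a k m) \<upsilon> s p q t w"
  by (simp add: N_weighted_def sum_distrib_left mult.assoc)

lemma N_weighted_cong:
  assumes "\<And>k m. k \<le> s \<Longrightarrow> m \<le> s \<Longrightarrow> a k m = b k m"
  shows "N_weighted a \<upsilon> s p q t w = N_weighted b \<upsilon> s p q t w"
  unfolding N_weighted_def by (intro sum.cong refl) (simp add: assms)

lemma Gamma_add_1_real: "(x::real) > 0 \<Longrightarrow> Gamma (x + 1) = x * Gamma x"
  by (rule Gamma_plus1) (auto elim!: nonpos_Ints_cases)

section \<open>Neighbouring polynomials as weighted sums\<close>

text \<open>
  The polynomial with indices $s - 1$ and $p - 1$ can be compared with the original one in two ways.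
  Matching the Gamma factor in the denominator exactly shifts $k$ by one, as here; keeping $k$,
  as in \<open>N_coeff_lower_p1'\<close>, leaves the factor $1/(p-2s+k)$ and corresponds to multiplication by $t$.
\<close>

lemma N_coeff_lower_p1:
  "real (Suc n) * N_coeff \<upsilon> n (p - 1) q k m = - real (Suc k) * N_coeff \<upsilon> (Suc n) p q (Suc k) m"
proof -
  have 1: "p - 1 - real n = p - real (Suc n)"
    "p - 1 - 2 * real n + real k = p - 2 * real (Suc n) + real (Suc k)" by simp_all
  have 2: "pochhammer (- real (Suc n)) (Suc k + m) = - real (Suc n) * pochhammer (- real n) (k + m)"
    by (simp add: pochhammer_rec)
  show ?thesis unfolding N_coeff_def 1 2 by (simp add: divide_simps del: of_nat_Suc)
qed

text \<open>Both sides are $-(-n-1)_{j+1}$, with either the first or the last factor split off.\<close>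

lemma pochhammer_neg_Suc:
  "real (Suc n) * pochhammer (- real n) j = (real (Suc n) - real j) * pochhammer (- real (Suc n)) j"
  using pochhammer_Suc[of "- real (Suc n)" j] pochhammer_rec[of "- real (Suc n)" j]
  by (simp add: algebra_simps)

lemma N_coeff_lower_p1':
  assumes "p - 2 * real (Suc n) > 0"
  shows "real (Suc n) * N_coeff \<upsilon> n (p - 1) q k m =
    (real (Suc n) - real k - real m) / (p - 2 * real (Suc n) + real k) * N_coeff \<upsilon> (Suc n) p q k m"
proof -
  define y where "y = p - 2 * real (Suc n) + real k"
  have y: "y > 0" using assms by (simp add: y_def)
  have 1: "p - 1 - real n = p - real (Suc n)" "p - 1 - 2 * real n + real k = y + 1"
    by (simp_all add: y_def)
  have "real (Suc n) * N_coeff \<upsilon> n (p - 1) q k m = Gamma (p - real (Suc n)) *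
      (real (Suc n) * pochhammer (- real n) (k + m)) /
      (Gamma (y + 1) * Gamma (q + 1 + real \<upsilon> * real m) * fact k * fact m)"
    unfolding N_coeff_def 1 by simp
  also have "\<dots> = (real (Suc n) - real k - real m) / y * N_coeff \<upsilon> (Suc n) p q k m"
    unfolding pochhammer_neg_Suc Gamma_add_1_real[OF y] N_coeff_def y_def[symmetric]
    by (simp add: algebra_simps)
  finally show ?thesis by (simp add: y_def)
qed

lemma N_coeff_lower_p2:
  assumes "p - real (Suc n) - 1 > 0"
  shows "real (Suc n) * (p - real (Suc n) - 1) * N_coeff \<upsilon> n (p - 2) q k m =
    (real (Suc n) - real k - real m) * N_coeff \<upsilon> (Suc n) p q k m"
proof -
  define x where "x = p - real (Suc n) - 1"
  have x: "x > 0" using assms by (simp add: x_def)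
  have 1: "p - 2 - real n = x" "p - 2 - 2 * real n + real k = p - 2 * real (Suc n) + real k"
    "p - real (Suc n) = x + 1"
    by (simp_all add: x_def)
  have "real (Suc n) * x * N_coeff \<upsilon> n (p - 2) q k m = x * Gamma x *
      (real (Suc n) * pochhammer (- real n) (k + m)) /
      (Gamma (p - 2 * real (Suc n) + real k) * Gamma (q + 1 + real \<upsilon> * real m) * fact k * fact m)"
    unfolding N_coeff_def 1 by simp
  also have "\<dots> = (real (Suc n) - real k - real m) * N_coeff \<upsilon> (Suc n) p q k m"
    unfolding pochhammer_neg_Suc N_coeff_def 1 Gamma_add_1_real[OF x]
    by (simp add: algebra_simps)
  finally show ?thesis by (simp add: x_def)
qed

lemma N_coeff_lower_p2_raise_q:
  assumes "p - real (Suc n) - 1 > 0"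
  shows "real (Suc n) * (p - real (Suc n) - 1) * N_coeff \<upsilon> n (p - 2) (q + real \<upsilon>) k m =
    - real (Suc m) * N_coeff \<upsilon> (Suc n) p q k (Suc m)"
proof -
  define x where "x = p - real (Suc n) - 1"
  have x: "x > 0" using assms by (simp add: x_def)
  have 1: "p - 2 - real n = x" "p - 2 - 2 * real n + real k = p - 2 * real (Suc n) + real k"
    "p - real (Suc n) = x + 1" "q + real \<upsilon> + 1 + real \<upsilon> * real m = q + 1 + real \<upsilon> * real (Suc m)"
    by (simp_all add: x_def algebra_simps)
  have 2: "pochhammer (- real (Suc n)) (k + Suc m) = - real (Suc n) * pochhammer (- real n) (k + m)"
    by (simp add: pochhammer_rec)
  show ?thesis
    unfolding N_coeff_def 2 x_def[symmetric] unfolding 1 Gamma_add_1_real[OF x]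
    by (simp add: divide_simps del: of_nat_Suc)
qed

lemma N_lower_p1_eq_weighted:
  "real s * N_Konhauser \<upsilon> (s - 1) (p - 1) q t w = N_weighted (\<lambda>k m. - real k) \<upsilon> s p q t w"
proof (cases s)
  case 0
  then show ?thesis by (simp add: N_weighted_def)
next
  case (Suc n)
  have "N_weighted (\<lambda>k m. - real k) \<upsilon> (Suc n) p q t w =
      (\<Sum>k\<le>n. \<Sum>m\<le>Suc n. - real (Suc k) * (N_coeff \<upsilon> (Suc n) p q (Suc k) m * t ^ (n - k) * w ^ (\<upsilon> * m)))"
    unfolding N_weighted_def by (subst sum.atMost_Suc_shift) (simp del: sum.atMost_Suc of_nat_Suc)
  also have "\<dots> = (\<Sum>k\<le>n. \<Sum>m\<le>n.
      - real (Suc k) * (N_coeff \<upsilon> (Suc n) p q (Suc k) m * t ^ (n - k) * w ^ (\<upsilon> * m)))"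
    by (simp add: N_coeff_eq_0 del: of_nat_Suc)
  also have "\<dots> = real (Suc n) * N_Konhauser \<upsilon> n (p - 1) q t w"
    unfolding N_Konhauser_eq_sum sum_distrib_left mult.assoc[symmetric] N_coeff_lower_p1 ..
  finally show ?thesis using Suc by simp
qed

text \<open>
  With a weight divisible by $s - k - m$, the terms on the diagonal $k + m = s$ disappear too, so
  the sum has the index range of the polynomial of index $s - 1$.
\<close>

lemma N_weighted_drop_top:
  assumes "\<And>k m. k + m = Suc n \<Longrightarrow> a k m = 0"
  shows "N_weighted a \<upsilon> (Suc n) p q t w =
    (\<Sum>k\<le>n. \<Sum>m\<le>n. a k m * (N_coeff \<upsilon> (Suc n) p q k m * t ^ (Suc n - k) * w ^ (\<upsilon> * m)))"
proof -
  have zero: "a k m * (N_coeff \<upsilon> (Suc n) p q k m * x * y) = 0" if "k = Suc n \<or> m = Suc n" for k m x y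
    using that assms[of k m] N_coeff_eq_0[of "Suc n" k m] by (cases "k + m = Suc n") auto
  show ?thesis unfolding N_weighted_def by (simp only: sum.atMost_Suc zero simp_thms) simp
qed

text \<open>An arbitrary weight is allowed here so that the rule can be applied to a polynomial of index
  $s - 2$ that is already written as a weighted sum of index $s - 1$.\<close>

lemma N_weighted_lower_p1:
  assumes "p - 2 * real s > 0"
  shows "real s * (t * N_weighted a \<upsilon> (s - 1) (p - 1) q t w) =
    N_weighted (\<lambda>k m. a k m * (real s - real k - real m) / (p - 2 * real s + real k)) \<upsilon> s p q t w"
proof (cases s)
  case 0
  then show ?thesis by (simp add: N_weighted_def)
next
  case (Suc n)
  have *: "real (Suc n) * (t * (a k m * (N_coeff \<upsilon> n (p - 1) q k m * t ^ (n - k) * w ^ (\<upsilon> * m)))) =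
    a k m * (real (Suc n) - real k - real m) / (p - 2 * real (Suc n) + real k) *
      (N_coeff \<upsilon> (Suc n) p q k m * t ^ (Suc n - k) * w ^ (\<upsilon> * m))" (is "?l = ?r") if "k \<le> n" for k m
  proof -
    have "?l = a k m * (real (Suc n) * N_coeff \<upsilon> n (p - 1) q k m) * (t ^ Suc (n - k)) * w ^ (\<upsilon> * m)"
      by (simp add: mult_ac)
    also have "\<dots> = ?r" using that assms unfolding Suc
      by (subst N_coeff_lower_p1') (simp_all add: Suc_diff_le mult_ac del: of_nat_Suc)
    finally show ?thesis .
  qed
  have "N_weighted (\<lambda>k m. a k m * (real (Suc n) - real k - real m) / (p - 2 * real (Suc n) + real k)) \<upsilon> (Suc n) p q t w
     = (\<Sum>k\<le>n. \<Sum>m\<le>n. a k m * (real (Suc n) - real k - real m) / (p - 2 * real (Suc n) + real k) *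
      (N_coeff \<upsilon> (Suc n) p q k m * t ^ (Suc n - k) * w ^ (\<upsilon> * m)))"
    by (rule N_weighted_drop_top) (simp flip: of_nat_add)
  then show ?thesis
    unfolding Suc by (simp add: N_weighted_def sum_distrib_left * del: of_nat_Suc)
qed

lemma N_lower_p2_eq_weighted:
  assumes "p - real s - 1 > 0"
  shows "real s * ((p - real s - 1) * (t * N_Konhauser \<upsilon> (s - 1) (p - 2) q t w)) =
    N_weighted (\<lambda>k m. real s - real k - real m) \<upsilon> s p q t w"
proof (cases s)
  case 0
  then show ?thesis by (simp add: N_weighted_def)
next
  case (Suc n)
  have *: "real (Suc n) * ((p - real (Suc n) - 1) * (t * (N_coeff \<upsilon> n (p - 2) q k m * t ^ (n - k) * w ^ (\<upsilon> * m)))) =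
    (real (Suc n) - real k - real m) *
      (N_coeff \<upsilon> (Suc n) p q k m * t ^ (Suc n - k) * w ^ (\<upsilon> * m))" (is "?l = ?r") if "k \<le> n" for k m
  proof -
    have "?l = (real (Suc n) * (p - real (Suc n) - 1) * N_coeff \<upsilon> n (p - 2) q k m) * (t ^ Suc (n - k)) * w ^ (\<upsilon> * m)"
      by (simp add: mult_ac)
    also have "\<dots> = ?r" using that assms unfolding Suc
      by (subst N_coeff_lower_p2) (simp_all add: Suc_diff_le mult_ac del: of_nat_Suc)
    finally show ?thesis .
  qed
  have "N_weighted (\<lambda>k m. real (Suc n) - real k - real m) \<upsilon> (Suc n) p q t w
     = (\<Sum>k\<le>n. \<Sum>m\<le>n. (real (Suc n) - real k - real m) *
      (N_coeff \<upsilon> (Suc n) p q k m * t ^ (Suc n - k) * w ^ (\<upsilon> * m)))"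
    by (rule N_weighted_drop_top) (simp flip: of_nat_add)
  then show ?thesis
    unfolding Suc by (simp add: N_Konhauser_eq_sum sum_distrib_left * del: of_nat_Suc)
qed

lemma N_lower_p2_raise_q_eq_weighted:
  assumes "p - real s - 1 > 0"
  shows "real s * ((p - real s - 1) * (t * (w ^ \<upsilon> * N_Konhauser \<upsilon> (s - 1) (p - 2) (q + real \<upsilon>) t w))) =
    N_weighted (\<lambda>k m. - real m) \<upsilon> s p q t w"
proof (cases s)
  case 0
  then show ?thesis by (simp add: N_weighted_def)
next
  case (Suc n)
  have *: "real (Suc n) * ((p - real (Suc n) - 1) * (t * (w ^ \<upsilon> *
      (N_coeff \<upsilon> n (p - 2) (q + real \<upsilon>) k m * t ^ (n - k) * w ^ (\<upsilon> * m))))) =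
    - real (Suc m) *
      (N_coeff \<upsilon> (Suc n) p q k (Suc m) * t ^ (Suc n - k) * w ^ (\<upsilon> * Suc m))" (is "?l = ?r") if "k \<le> n" for k m
  proof -
    have "?l = (real (Suc n) * (p - real (Suc n) - 1) * N_coeff \<upsilon> n (p - 2) (q + real \<upsilon>) k m) *
        (t ^ Suc (n - k)) * w ^ (\<upsilon> * Suc m)"
      by (simp add: mult_ac power_add)
    also have "\<dots> = ?r" using that assms unfolding Suc
      by (subst N_coeff_lower_p2_raise_q) (simp_all add: Suc_diff_le mult_ac del: of_nat_Suc)
    finally show ?thesis .
  qed
  have "N_weighted (\<lambda>k m. - real m) \<upsilon> (Suc n) p q t w
     = (\<Sum>k\<le>Suc n. \<Sum>m\<le>n. - real (Suc m) *
      (N_coeff \<upsilon> (Suc n) p q k (Suc m) * t ^ (Suc n - k) * w ^ (\<upsilon> * Suc m)))"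
    unfolding N_weighted_def by (simp only: sum.atMost_Suc_shift[of _ n]) simp
  also have "\<dots> = (\<Sum>k\<le>n. \<Sum>m\<le>n. - real (Suc m) *
      (N_coeff \<upsilon> (Suc n) p q k (Suc m) * t ^ (Suc n - k) * w ^ (\<upsilon> * Suc m)))"
    by (simp add: N_coeff_eq_0)
  finally show ?thesis
    unfolding Suc by (simp add: N_Konhauser_eq_sum sum_distrib_left * del: of_nat_Suc)
qed

lemma N_lower_twice_eq_weighted:
  assumes "p - 2 * real s > 0"
  shows "real s * ((real s - 1) * (t * N_Konhauser \<upsilon> (s - 2) (p - 2) q t w)) =
    N_weighted (\<lambda>k m. - real k * (real s - real k - real m) / (p - 2 * real s + real k)) \<upsilon> s p q t w"
proof (cases "s = 0")
  case True
  then show ?thesis by (simp add: N_weighted_def)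
next
  case False
  then have "real (s - 1) = real s - 1" "s - 1 - 1 = s - 2" "p - 1 - 1 = p - 2" by auto
  then have "(real s - 1) * N_Konhauser \<upsilon> (s - 2) (p - 2) q t w =
      N_weighted (\<lambda>k m. - real k) \<upsilon> (s - 1) (p - 1) q t w"
    using N_lower_p1_eq_weighted[of "s - 1" \<upsilon> "p - 1" q t w] by simp
  then show ?thesis
    using N_weighted_lower_p1[OF assms, of t "\<lambda>k m. - real k" \<upsilon> q w] by (simp add: mult_ac)
qed

section \<open>Partial derivatives\<close>

lemma N_has_derivative_t:
  "((\<lambda>t. N_Konhauser \<upsilon> s p q t w) has_real_derivative
     (\<Sum>k\<le>s. \<Sum>m\<le>s. N_coeff \<upsilon> s p q k m * (real (s - k) * t ^ (s - k - 1)) * w ^ (\<upsilon> * m))) (at t)"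
  unfolding N_Konhauser_eq_sum by (auto intro!: derivative_eq_intros sum.cong)

lemma N_has_derivative_w:
  "((\<lambda>w. N_Konhauser \<upsilon> s p q t w) has_real_derivative
     (\<Sum>k\<le>s. \<Sum>m\<le>s. N_coeff \<upsilon> s p q k m * t ^ (s - k) * (real (\<upsilon> * m) * w ^ (\<upsilon> * m - 1)))) (at w)"
  unfolding N_Konhauser_eq_sum by (auto intro!: derivative_eq_intros sum.cong)

lemma times_power_pred: "(x::real) * (real n * x ^ (n - 1)) = real n * x ^ n"
  by (cases n) simp_all

lemma deriv_t_eq_weighted:
  "t * deriv (\<lambda>t. N_Konhauser \<upsilon> s p q t w) t = N_weighted (\<lambda>k m. real s - real k) \<upsilon> s p q t w"
proof -
  have "t * (c * (real (s - k) * t ^ (s - k - 1)) * d) = (real s - real k) * (c * t ^ (s - k) * d)"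
    if "k \<le> s" for k c d
    using times_power_pred[of t "s - k"] that by (metis mult.assoc mult.left_commute of_nat_diff)
  then show ?thesis
    unfolding DERIV_imp_deriv[OF N_has_derivative_t] N_weighted_def sum_distrib_left
    by (intro sum.cong) auto
qed

lemma deriv_w_eq_weighted:
  "w * deriv (\<lambda>w. N_Konhauser \<upsilon> s p q t w) w = real \<upsilon> * N_weighted (\<lambda>k m. real m) \<upsilon> s p q t w"
proof -
  have "w * (c * (real (\<upsilon> * m) * w ^ (\<upsilon> * m - 1))) = real \<upsilon> * (real m * (c * w ^ (\<upsilon> * m)))"
    for m c
    using times_power_pred[of w "\<upsilon> * m"] by (metis mult.assoc mult.left_commute of_nat_mult)
  then show ?thesis
    unfolding DERIV_imp_deriv[OF N_has_derivative_w] N_weighted_def sum_distrib_left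
    by (simp only:)
qed

lemma isCont_N_t: "isCont (\<lambda>t. N_Konhauser \<upsilon> s p q t w) t"
  by (rule DERIV_isCont[OF N_has_derivative_t])

lemma isCont_N_w: "isCont (\<lambda>w. N_Konhauser \<upsilon> s p q t w) w"
  by (rule DERIV_isCont[OF N_has_derivative_w])

lemma isCont_deriv_N_t: "isCont (\<lambda>t. deriv (\<lambda>t. N_Konhauser \<upsilon> s p q t w) t) t"
  unfolding DERIV_imp_deriv[OF N_has_derivative_t] by (intro continuous_intros)

lemma isCont_deriv_N_w: "isCont (\<lambda>w. deriv (\<lambda>w. N_Konhauser \<upsilon> s p q t w) w) w"
  unfolding DERIV_imp_deriv[OF N_has_derivative_w] by (intro continuous_intros)

text \<open>The weights describe $t D_t N$ and $w D_w N$; this recovers $D_t N$ and $D_w N$ at $0$ as well.\<close>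

lemma cancel_variable:
  fixes f g :: "real \<Rightarrow> real"
  assumes "\<And>x. x * f x = x * g x" "isCont f 0" "isCont g 0"
  shows "f x = g x"
proof (cases "x = 0")
  case True
  have "eventually (\<lambda>x. f x = g x) (at 0)"
    unfolding eventually_at_filter using assms(1) by (intro always_eventually) (metis mult_cancel_left)
  then have "(g \<longlongrightarrow> f 0) (at 0)"
    using assms(2) by (auto simp: isCont_def intro: Lim_transform_eventually)
  with assms(3) show ?thesis
    unfolding True isCont_def by (intro tendsto_unique[OF trivial_limit_at, of g]) auto
qed (use assms(1)[of x] in simp)

lemma deriv_N_t_lower:
  assumes "p - 2 * real s > 1"
  shows "deriv (\<lambda>t. N_Konhauser \<upsilon> s p q t w) t =
       real s * (real s + 1 - p) * w ^ \<upsilon> * N_Konhauser \<upsilon> (s - 1) (p - 2) (q + real \<upsilon>) t w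
       - real s * (real s - 1) * N_Konhauser \<upsilon> (s - 2) (p - 2) q t w
       + real s * (p - 2 * real s) * N_Konhauser \<upsilon> (s - 1) (p - 1) q t w" (is "?D t = ?R t")
proof (rule cancel_variable[where f = ?D and g = ?R])
  fix t
  have pos: "p - 2 * real s > 0" "p - real s - 1 > 0" using assms by simp_all
  have "t * (real s * (real s + 1 - p) * w ^ \<upsilon> * N_Konhauser \<upsilon> (s - 1) (p - 2) (q + real \<upsilon>) t w
       - real s * (real s - 1) * N_Konhauser \<upsilon> (s - 2) (p - 2) q t w
       + real s * (p - 2 * real s) * N_Konhauser \<upsilon> (s - 1) (p - 1) q t w) =
     (- 1) * (real s * ((p - real s - 1) * (t * (w ^ \<upsilon> * N_Konhauser \<upsilon> (s - 1) (p - 2) (q + real \<upsilon>) t w))))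
     + ((- 1) * (real s * ((real s - 1) * (t * N_Konhauser \<upsilon> (s - 2) (p - 2) q t w)))
     + (p - 2 * real s) * (real s * (t * N_Konhauser \<upsilon> (s - 1) (p - 1) q t w)))"
    by (simp add: algebra_simps)
  also have "\<dots> = N_weighted (\<lambda>k m. real s - real k) \<upsilon> s p q t w"
    unfolding N_lower_p2_raise_q_eq_weighted[OF pos(2)] N_lower_twice_eq_weighted[OF pos(1)]
      N_Konhauser_eq_weighted[of _ "s - 1" "p - 1"] N_weighted_lower_p1[OF pos(1)]
    unfolding N_weighted_cmult N_weighted_add
  proof (rule N_weighted_cong)
    fix k m
    have "p - 2 * real s + real k > 0" using pos by simp
    then show "- 1 * - real m + (- 1 * (- real k * (real s - real k - real m) / (p - 2 * real s + real k)) +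
        (p - 2 * real s) * (1 * (real s - real k - real m) / (p - 2 * real s + real k))) = real s - real k"
      by (simp add: divide_simps) (simp add: algebra_simps)
  qed
  finally show "t * ?D t = t * ?R t"
    by (simp only: deriv_t_eq_weighted)
qed (intro continuous_intros isCont_deriv_N_t isCont_N_t)+

lemma times_deriv_N_t:
  "t * deriv (\<lambda>t. N_Konhauser \<upsilon> s p q t w) t =
     real s * (N_Konhauser \<upsilon> s p q t w + N_Konhauser \<upsilon> (s - 1) (p - 1) q t w)"
  unfolding deriv_t_eq_weighted distrib_left N_lower_p1_eq_weighted
  unfolding N_Konhauser_eq_weighted N_weighted_cmult N_weighted_add
  by (rule N_weighted_cong) simp

lemma times_deriv_N_w:
  assumes "p - real s - 1 > 0"
  shows "w * deriv (\<lambda>w. N_Konhauser \<upsilon> s p q t w) w =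
    real s * real \<upsilon> * (N_Konhauser \<upsilon> s p q t w + N_Konhauser \<upsilon> (s - 1) (p - 1) q t w
      - (p - real s - 1) * t * N_Konhauser \<upsilon> (s - 1) (p - 2) q t w)"
proof -
  have "real s * real \<upsilon> * (N_Konhauser \<upsilon> s p q t w + N_Konhauser \<upsilon> (s - 1) (p - 1) q t w
      - (p - real s - 1) * t * N_Konhauser \<upsilon> (s - 1) (p - 2) q t w) =
    real \<upsilon> * (real s * N_Konhauser \<upsilon> s p q t w + (real s * N_Konhauser \<upsilon> (s - 1) (p - 1) q t w
      + (- 1) * (real s * ((p - real s - 1) * (t * N_Konhauser \<upsilon> (s - 1) (p - 2) q t w)))))"
    by (simp add: algebra_simps)
  also have "\<dots> = real \<upsilon> * N_weighted (\<lambda>k m. real m) \<upsilon> s p q t w"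
    unfolding N_lower_p1_eq_weighted N_lower_p2_eq_weighted[OF assms]
    unfolding N_Konhauser_eq_weighted N_weighted_cmult N_weighted_add
    by (rule N_weighted_cong) (simp add: algebra_simps)
  finally show ?thesis by (simp only: deriv_w_eq_weighted)
qed

lemma deriv_N_w:
  assumes "p - real s - 1 > 0" "\<upsilon> \<ge> 1"
  shows "deriv (\<lambda>w. N_Konhauser \<upsilon> s p q t w) w =
       - real s * real \<upsilon> * (p - real s - 1) * t * w ^ (\<upsilon> - 1) *
       N_Konhauser \<upsilon> (s - 1) (p - 2) (q + real \<upsilon>) t w" (is "?D w = ?R w")
proof (rule cancel_variable[where f = ?D and g = ?R])
  fix w :: real
  have pw: "w ^ \<upsilon> = w * w ^ (\<upsilon> - 1)" using assms(2) by (cases \<upsilon>) auto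
  have "w * (- real s * real \<upsilon> * (p - real s - 1) * t * w ^ (\<upsilon> - 1) *
       N_Konhauser \<upsilon> (s - 1) (p - 2) (q + real \<upsilon>) t w) =
      - real \<upsilon> * (real s * ((p - real s - 1) * (t * (w ^ \<upsilon> * N_Konhauser \<upsilon> (s - 1) (p - 2) (q + real \<upsilon>) t w))))"
    by (simp only: pw mult_ac mult_minus_left mult_minus_right)
  also have "\<dots> = real \<upsilon> * N_weighted (\<lambda>k m. real m) \<upsilon> s p q t w"
    unfolding N_lower_p2_raise_q_eq_weighted[OF assms(1)] N_weighted_cmult
    by (rule N_weighted_cong) simp
  finally show "w * ?D w = w * ?R w"
    by (simp only: deriv_w_eq_weighted)
qed (intro continuous_intros isCont_deriv_N_w isCont_N_w)+

section \<open>Iterated derivatives and integrals\<close>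

text \<open>
  The chain \<open>g\<close> is required on the positive half-line only; this suffices because differentiation is
  local. The finite part integral likewise ignores the values at $0$ and below.
\<close>

lemma iterated_deriv_eqI:
  fixes g :: "nat \<Rightarrow> real \<Rightarrow> real"
  assumes g0: "\<And>x. x > 0 \<Longrightarrow> f x = g 0 x"
    and step: "\<And>j x. j < m \<Longrightarrow> x > 0 \<Longrightarrow> (g j has_real_derivative g (Suc j) x) (at x)"
  shows "x > 0 \<Longrightarrow> (deriv ^^ m) f x = g m x"
  using step
proof (induction m arbitrary: x)
  case 0
  then show ?case by (simp add: g0)
next
  case (Suc m)
  have "eventually (\<lambda>y. y > 0) (nhds x)"
    using Suc.prems(1) by (intro eventually_nhds_in_open[of "{0<..}", simplified]) auto
  then have "eventually (\<lambda>y. (deriv ^^ m) f y = g m y) (nhds x)"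
    by eventually_elim (use Suc in auto)
  then have "deriv ((deriv ^^ m) f) x = deriv (g m) x" by (rule deriv_cong_ev) simp
  also have "\<dots> = g (Suc m) x" using Suc.prems by (intro DERIV_imp_deriv) auto
  finally show ?case by simp
qed

lemma finite_part_integral_cong:
  assumes "\<And>y. y > 0 \<Longrightarrow> f y = g y"
  shows "finite_part_integral_from_0 f x = finite_part_integral_from_0 g x"
proof -
  have "f integrable_on {e..x} \<longleftrightarrow> g integrable_on {e..x}" if "e > 0" for e
    by (rule integrable_cong) (use that assms in auto)
  moreover have "eventually (\<lambda>e. integral {e..x} f = integral {e..x} g) (at_right 0)"
    by (rule eventually_at_rightI[of 0 1]) (auto intro!: integral_cong assms)
  then have "((\<lambda>e. integral {e..x} f - S e - R e) \<longlongrightarrow> L) (at_right 0) \<longleftrightarrow>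
      ((\<lambda>e. integral {e..x} g - S e - R e) \<longlongrightarrow> L) (at_right 0)" for S R L
    by (intro tendsto_cong) (auto elim: eventually_mono)
  ultimately have "has_finite_part_integral f x L \<longleftrightarrow> has_finite_part_integral g x L" for L
    unfolding has_finite_part_integral_def by auto
  then show ?thesis by (simp add: finite_part_integral_from_0_def)
qed

lemma iterated_finite_part_integral_eqI:
  fixes g :: "nat \<Rightarrow> real \<Rightarrow> real"
  assumes g0: "\<And>x. x > 0 \<Longrightarrow> f x = g 0 x"
    and step: "\<And>j x. j < m \<Longrightarrow> x > 0 \<Longrightarrow> has_finite_part_integral (g j) x (g (Suc j) x)"
  shows "x > 0 \<Longrightarrow> (finite_part_integral_from_0 ^^ m) f x = g m x"
  using step
proof (induction m arbitrary: x)
  case 0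
  then show ?case by (simp add: g0)
next
  case (Suc m)
  have "finite_part_integral_from_0 ((finite_part_integral_from_0 ^^ m) f) x = finite_part_integral_from_0 (g m) x"
    by (rule finite_part_integral_cong) (use Suc in auto)
  also have "\<dots> = g (Suc m) x" using Suc.prems by (intro finite_part_integral_from_0_eqI) auto
  finally show ?case by simp
qed

text \<open>
  With the factor $\Gamma(x+k)$ built in, differentiation changes nothing but $x$ and the sign.
\<close>

definition Gamma_powr_sum :: "(nat \<Rightarrow> real) \<Rightarrow> nat \<Rightarrow> real \<Rightarrow> real \<Rightarrow> real" where
  "Gamma_powr_sum a n x t = (\<Sum>k\<le>n. a k * Gamma (x + real k) * t powr (- (x + real k)))"

lemma Gamma_powr_sum_has_derivative:
  assumes "x > 0" "t > 0"
  shows "(Gamma_powr_sum a n x has_real_derivative - Gamma_powr_sum a n (x + 1) t) (at t)"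
proof -
  have "a k * Gamma (x + real k) * (- (x + real k) * t powr (- (x + real k) - 1)) =
      - (a k * Gamma (x + 1 + real k) * t powr (- (x + 1 + real k)))" for k
  proof -
    have 1: "x + 1 + real k = (x + real k) + 1" by simp
    have 2: "- (x + real k) - 1 = - ((x + real k) + 1)" by simp
    have 3: "Gamma ((x + real k) + 1) = (x + real k) * Gamma (x + real k)"
      using assms(1) by (intro Gamma_add_1_real) simp
    show ?thesis unfolding 1 2 3 by (simp add: algebra_simps)
  qed
  then have "- Gamma_powr_sum a n (x + 1) t =
      (\<Sum>k\<le>n. a k * Gamma (x + real k) * (- (x + real k) * t powr (- (x + real k) - 1)))"
    by (simp add: Gamma_powr_sum_def sum_negf)
  moreover have "((\<lambda>t. \<Sum>k\<le>n. a k * Gamma (x + real k) * t powr (- (x + real k))) has_real_derivative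
      (\<Sum>k\<le>n. a k * Gamma (x + real k) * (- (x + real k) * t powr (- (x + real k) - 1)))) (at t)"
    using assms(2) by (intro DERIV_sum DERIV_cmult has_real_derivative_powr)
  ultimately show ?thesis by (simp add: Gamma_powr_sum_def[abs_def])
qed

lemma Gamma_powr_sum_finite_part_integral:
  assumes "x > 0" "t > 0"
  shows "has_finite_part_integral (\<lambda>t. c * Gamma_powr_sum a n (x + 1) t) t (- c * Gamma_powr_sum a n x t)"
proof -
  have int: "((\<lambda>t. c * Gamma_powr_sum a n (x + 1) t) has_integral
      (- c * Gamma_powr_sum a n x t) - (- c * Gamma_powr_sum a n x e)) {e..t}" if "0 < e" "e \<le> t" for e
  proof (rule fundamental_theorem_of_calculus[OF that(2)])
    fix y assume "y \<in> {e..t}"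
    then have "((\<lambda>t. - c * Gamma_powr_sum a n x t) has_real_derivative - c * - Gamma_powr_sum a n (x + 1) y) (at y)"
      using that assms(1) by (intro DERIV_cmult Gamma_powr_sum_has_derivative) auto
    then show "((\<lambda>t. - c * Gamma_powr_sum a n x t) has_vector_derivative c * Gamma_powr_sum a n (x + 1) y)
        (at y within {e..t})"
      by (simp add: has_real_derivative_iff_has_vector_derivative has_vector_derivative_at_within)
  qed
  (* The singular part of the integral over [e, t] is c * Gamma_powr_sum a n x e. Its terms are indexed
     by their exponents y = x + k, so k is recovered from y as the floor of y - x. *)
  define A where "A = (\<lambda>k. x + real k) ` {..n}"
  define d where "d y = c * (a (nat \<lfloor>y - x\<rfloor>) * Gamma y)" for y
  have A: "(\<Sum>y\<in>A. d y * e powr (- y)) = c * Gamma_powr_sum a n x e" for e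
    unfolding A_def by (subst sum.reindex)
      (auto simp: inj_on_def d_def Gamma_powr_sum_def sum_distrib_left mult_ac intro!: sum.cong)
  have "eventually (\<lambda>e. integral {e..t} (\<lambda>t. c * Gamma_powr_sum a n (x + 1) t)
      - (\<Sum>y\<in>A. d y * e powr (- y)) - 0 * ln e = - c * Gamma_powr_sum a n x t) (at_right 0)"
    by (rule eventually_at_rightI[of 0 t]) (use assms int[THEN integral_unique] in \<open>auto simp: A simp del: integral_mult_right\<close>)
  then have "((\<lambda>e. integral {e..t} (\<lambda>t. c * Gamma_powr_sum a n (x + 1) t)
      - (\<Sum>y\<in>A. d y * e powr (- y)) - 0 * ln e) \<longlongrightarrow> - c * Gamma_powr_sum a n x t) (at_right 0)"
    by (rule tendsto_eventually)
  moreover have "finite A" "A \<subseteq> {0<..}" using assms by (auto simp: A_def)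
  ultimately show ?thesis
    unfolding has_finite_part_integral_def using has_integral_integrable[OF int]
    by (intro conjI ballI exI[of _ A] exI[of _ d] exI[of _ 0]) auto
qed

text \<open>
  Up to $\Gamma(p-s)/\Gamma(p-2s+k)$ this is the coefficient of $t^{s-k}$; it does not involve $p$,
  which is why operators in $t$ can change $p$ alone.
\<close>

definition N_w_part :: "nat \<Rightarrow> nat \<Rightarrow> real \<Rightarrow> real \<Rightarrow> nat \<Rightarrow> real" where
  "N_w_part \<upsilon> s q w k =
     (\<Sum>m\<le>s. pochhammer (- real s) (k + m) * w ^ (\<upsilon> * m) / (Gamma (q + 1 + real \<upsilon> * real m) * fact k * fact m))"

lemma powr_times_N_Konhauser:
  assumes "t > 0"
  shows "t powr y * N_Konhauser \<upsilon> s p q t w = Gamma (p - real s) *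
    (\<Sum>k\<le>s. N_w_part \<upsilon> s q w k / Gamma (p - 2 * real s + real k) * t powr (y + real s - real k))"
proof -
  have "t powr y * (N_coeff \<upsilon> s p q k m * t ^ (s - k) * w ^ (\<upsilon> * m)) =
     Gamma (p - real s) * (pochhammer (- real s) (k + m) * w ^ (\<upsilon> * m) / (Gamma (q + 1 + real \<upsilon> * real m) * fact k * fact m)
       / Gamma (p - 2 * real s + real k) * t powr (y + real s - real k))" if "k \<le> s" for k m
  proof -
    have "t powr (y + real s - real k) = t powr y * t ^ (s - k)"
      using assms that by (simp add: powr_realpow[symmetric] powr_add[symmetric] of_nat_diff algebra_simps)
    then show ?thesis by (simp add: N_coeff_def mult_ac)
  qed
  then show ?thesis
    unfolding N_Konhauser_eq_sum N_w_part_def sum_distrib_left sum_divide_distrib sum_distrib_right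
    by (intro sum.cong) auto
qed

text \<open>
  The coefficients \<open>a\<close> contain both Gamma factors, for \<open>p\<close> and for \<open>p - m\<close>. Multiplication by
  $\Gamma(x+k)$ cancels one of them: $x = p-m-2s$ leaves the denominators of $N^{(p,q)}$, and
  $x = p-2s$ those of $N^{(p-m,q)}$.
\<close>

lemma powr_N_eq_Gamma_powr_sum:
  fixes \<upsilon> s m :: nat and p q w :: real
  defines "a \<equiv> \<lambda>k. N_w_part \<upsilon> s q w k /
      (Gamma (p - real m - 2 * real s + real k) * Gamma (p - 2 * real s + real k))"
  assumes "p - real m - 2 * real s > 0" "t > 0"
  shows "t powr (real s - p + real m) * N_Konhauser \<upsilon> s p q t w =
      Gamma (p - real s) * Gamma_powr_sum a s (p - real m - 2 * real s) t" (is ?th1)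
    and "t powr (real s - p) * N_Konhauser \<upsilon> s (p - real m) q t w =
      Gamma (p - real m - real s) * Gamma_powr_sum a s (p - 2 * real s) t" (is ?th2)
proof -
  have pos: "Gamma (p - real m - 2 * real s + real k) > 0" "Gamma (p - 2 * real s + real k) > 0" for k
    using assms(2) by (auto intro!: Gamma_real_pos)
  note nz = pos[THEN less_imp_neq, symmetric]
  have e1: "real s - p + real m + real s - real k = - (p - real m - 2 * real s + real k)"
    and e2: "real s - p + real s - real k = - (p - 2 * real s + real k)" for k
    by simp_all
  show ?th1 unfolding powr_times_N_Konhauser[OF assms(3)] Gamma_powr_sum_def a_def e1
    by (intro arg_cong2[where f = "(*)"] sum.cong refl) (simp add: nz)
  show ?th2 unfolding powr_times_N_Konhauser[OF assms(3)] Gamma_powr_sum_def a_def e2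
    by (intro arg_cong2[where f = "(*)"] sum.cong refl) (simp add: nz)
qed

lemma iterated_deriv_N_t:
  assumes "real m < p - 2 * real s" "t > 0"
  shows "(deriv ^^ m) (\<lambda>t. t powr (real s - p + real m) * N_Konhauser \<upsilon> s p q t w) t =
       (-1) ^ m * Gamma (p - real s) / Gamma (p - real m - real s) *
       t powr (real s - p) * N_Konhauser \<upsilon> s (p - real m) q t w"
proof -
  define a where "a k = N_w_part \<upsilon> s q w k /
      (Gamma (p - real m - 2 * real s + real k) * Gamma (p - 2 * real s + real k))" for k
  define g where "g j t = Gamma (p - real s) * (-1) ^ j *
      Gamma_powr_sum a s (p - real m - 2 * real s + real j) t" for j t
  have pos: "p - real m - 2 * real s > 0" using assms by simp
  have "(deriv ^^ m) (\<lambda>t. t powr (real s - p + real m) * N_Konhauser \<upsilon> s p q t w) t = g m t"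
  proof (rule iterated_deriv_eqI)
    fix t :: real assume "t > 0"
    then show "t powr (real s - p + real m) * N_Konhauser \<upsilon> s p q t w = g 0 t"
      using powr_N_eq_Gamma_powr_sum(1)[OF pos] by (simp add: g_def a_def[abs_def])
  next
    fix j and x :: real assume "x > 0"
    then have "(g j has_real_derivative Gamma (p - real s) * (-1) ^ j *
       - Gamma_powr_sum a s (p - real m - 2 * real s + real j + 1) x) (at x)"
      unfolding g_def[abs_def] using pos
      by (intro DERIV_cmult Gamma_powr_sum_has_derivative) auto
    then show "(g j has_real_derivative g (Suc j) x) (at x)" by (simp add: g_def add_ac)
  qed (fact assms)
  moreover have "Gamma (p - real m - real s) \<noteq> 0"
    using pos by (intro less_imp_neq[symmetric] Gamma_real_pos) simp
  ultimately show ?thesis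
    using powr_N_eq_Gamma_powr_sum(2)[OF pos assms(2), of \<upsilon> q w]
    by (simp add: g_def a_def[abs_def] mult.assoc)
qed

text \<open>The previous formula with $p + m$ in place of $p$, traversed backwards.\<close>

lemma iterated_finite_part_integral_N_t:
  assumes "p - 2 * real s > 0" "t > 0"
  shows "(finite_part_integral_from_0 ^^ m) (\<lambda>t. t powr (real s - p - real m) * N_Konhauser \<upsilon> s p q t w) t =
       (-1) ^ m * Gamma (p - real s) / Gamma (p - real s + real m) *
       t powr (real s - p) * N_Konhauser \<upsilon> s (p + real m) q t w"
proof -
  define a where "a k = N_w_part \<upsilon> s q w k /
      (Gamma (p - 2 * real s + real k) * Gamma (p + real m - 2 * real s + real k))" for k
  define g where "g j t = Gamma (p - real s) * (-1) ^ j *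
      Gamma_powr_sum a s (p + real m - 2 * real s - real j) t" for j t
  have pos: "p + real m - real m - 2 * real s > 0" using assms by simp
  have "(finite_part_integral_from_0 ^^ m) (\<lambda>t. t powr (real s - p - real m) * N_Konhauser \<upsilon> s p q t w) t = g m t"
  proof (rule iterated_finite_part_integral_eqI)
    fix t :: real assume t: "t > 0"
    have e: "real s - (p + real m) = real s - p - real m" by simp
    show "t powr (real s - p - real m) * N_Konhauser \<upsilon> s p q t w = g 0 t"
      using powr_N_eq_Gamma_powr_sum(2)[OF pos t, of \<upsilon> q w] unfolding e
      by (simp add: g_def a_def[abs_def])
  next
    fix j and x :: real assume "j < m" and x: "x > 0"
    then have *: "p + real m - 2 * real s - real (Suc j) > 0" using pos by auto
    have e: "p + real m - 2 * real s - real (Suc j) + 1 = p + real m - 2 * real s - real j" by simp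
    show "has_finite_part_integral (g j) x (g (Suc j) x)"
      using Gamma_powr_sum_finite_part_integral[OF * x, of "Gamma (p - real s) * (-1) ^ j" a s] unfolding e
      by (simp add: g_def[abs_def])
  qed (fact assms)
  moreover have "Gamma (p + real m - real s) \<noteq> 0"
    using pos by (intro less_imp_neq[symmetric] Gamma_real_pos) simp
  moreover have e: "p - real s + real m = p + real m - real s" and
    "real s - (p + real m) + real m = real s - p"
    "p + real m - 2 * real s - real m = p - 2 * real s" by simp_all
  ultimately show ?thesis
    unfolding e
    using powr_N_eq_Gamma_powr_sum(1)[OF pos assms(2), of \<upsilon> q w]
    by (simp add: g_def a_def[abs_def] mult.assoc)
qed

text \<open>Differentiating $w^{q+\upsilon m}$ produces the factor that turns $1/\Gamma(q+1+\upsilon m)$ into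
  $1/\Gamma(q+\upsilon m)$.\<close>

lemma powr_N_has_derivative_w:
  assumes "q > 0" "w > 0"
  shows "((\<lambda>w. w powr q * N_Konhauser \<upsilon> s p q t w) has_real_derivative
    w powr (q - 1) * N_Konhauser \<upsilon> s p (q - 1) t w) (at w)"
proof -
  define b where "b k m = N_coeff \<upsilon> s p q k m * t ^ (s - k)" for k m
  have shift: "N_coeff \<upsilon> s p (q - 1) k m = (q + real (\<upsilon> * m)) * N_coeff \<upsilon> s p q k m" for k m
  proof -
    have pos: "q + real \<upsilon> * real m > 0" using assms by (simp add: add_pos_nonneg)
    have 1: "q - 1 + 1 + real \<upsilon> * real m = q + real \<upsilon> * real m"
      "q + 1 + real \<upsilon> * real m = (q + real \<upsilon> * real m) + 1" by simp_all
    show ?thesis unfolding N_coeff_def 1 Gamma_add_1_real[OF pos] using pos by simp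
  qed
  have pw: "x powr r * (c * x ^ n) = c * x powr (r + real n)" if "x > 0" for x r c :: real and n
    using that by (simp add: powr_add powr_realpow)
  have "((\<lambda>w. \<Sum>k\<le>s. \<Sum>m\<le>s. b k m * w powr (q + real (\<upsilon> * m))) has_real_derivative
      (\<Sum>k\<le>s. \<Sum>m\<le>s. b k m * ((q + real (\<upsilon> * m)) * w powr (q + real (\<upsilon> * m) - 1)))) (at w)"
    using assms by (intro DERIV_sum DERIV_cmult has_real_derivative_powr)
  also have "(\<Sum>k\<le>s. \<Sum>m\<le>s. b k m * ((q + real (\<upsilon> * m)) * w powr (q + real (\<upsilon> * m) - 1))) =
      w powr (q - 1) * N_Konhauser \<upsilon> s p (q - 1) t w"
    unfolding N_Konhauser_eq_sum sum_distrib_left shift b_def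
    by (intro sum.cong refl, simp only: pw[OF assms(2)]) (simp add: diff_add_eq mult_ac)
  finally show ?thesis
  proof (rule has_field_derivative_transform_within_open[of _ _ _ "{0<..}"])
    fix x :: real assume "x \<in> {0<..}"
    then show "(\<Sum>k\<le>s. \<Sum>m\<le>s. b k m * x powr (q + real (\<upsilon> * m))) = x powr q * N_Konhauser \<upsilon> s p q t x"
      unfolding N_Konhauser_eq_sum sum_distrib_left b_def
      by (simp add: pw)
  qed (use assms in auto)
qed

text \<open>
  The bound $q - m > -1$, weaker than $m \le q$, and the constant factor \<open>c\<close> are needed for
  $D_w^\upsilon w^{q+1} D_w$: there $q + \upsilon$ is lowered to an arbitrary $q > -1$.
\<close>

lemma iterated_deriv_N_w:
  assumes f: "\<And>x. x > 0 \<Longrightarrow> f x = c * (x powr q * N_Konhauser \<upsilon> s p q t x)"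
    and "q - real m > - 1" "w > 0"
  shows "(deriv ^^ m) f w = c * (w powr (q - real m) * N_Konhauser \<upsilon> s p (q - real m) t w)"
proof -
  define g where "g j x = c * (x powr (q - real j) * N_Konhauser \<upsilon> s p (q - real j) t x)" for j x
  have "(deriv ^^ m) f w = g m w"
  proof (rule iterated_deriv_eqI)
    fix j and x :: real assume "j < m" and x: "x > 0"
    then have "real j + 1 \<le> real m" by simp
    then have *: "q - real j > 0" using assms(2) by simp
    have "q - real (Suc j) = q - real j - 1" by simp
    then show "(g j has_real_derivative g (Suc j) x) (at x)"
      unfolding g_def[abs_def] by (simp only:) (intro DERIV_cmult powr_N_has_derivative_w[OF * x])
  qed (simp_all add: f g_def assms(3))
  then show ?thesis by (simp add: g_def)
qed

lemma integral_powr_N_w: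
  assumes "q > -1" "w \<ge> 0"
  shows "integral {0..w} (\<lambda>w. w powr q * N_Konhauser \<upsilon> s p q t w) =
    w powr (q + 1) * N_Konhauser \<upsilon> s p (q + 1) t w"
proof -
  have "((\<lambda>w. w powr q * N_Konhauser \<upsilon> s p q t w) has_integral
     w powr (q + 1) * N_Konhauser \<upsilon> s p (q + 1) t w - 0 powr (q + 1) * N_Konhauser \<upsilon> s p (q + 1) t 0) {0..w}"
  proof (rule fundamental_theorem_of_calculus_interior[OF assms(2)])
    have "continuous_on {0..w} (\<lambda>w. N_Konhauser \<upsilon> s p (q + 1) t w)"
      using isCont_N_w by (intro continuous_at_imp_continuous_on) auto
    then show "continuous_on {0..w} (\<lambda>w. w powr (q + 1) * N_Konhauser \<upsilon> s p (q + 1) t w)"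
      using assms by (intro continuous_on_mult continuous_on_powr' continuous_intros) auto
  next
    fix x assume "x \<in> {0<..<w}"
    then show "((\<lambda>w. w powr (q + 1) * N_Konhauser \<upsilon> s p (q + 1) t w) has_vector_derivative
        x powr q * N_Konhauser \<upsilon> s p q t x) (at x)"
      using powr_N_has_derivative_w[of "q + 1" x \<upsilon> s p t] assms
      by (simp add: has_real_derivative_iff_has_vector_derivative)
  qed
  then show ?thesis by (simp add: integral_unique)
qed

text \<open>The point $w = 0$ is included, so that the inner integrals agree on the whole of $[0, w]$; there
  both sides are $0$, as \<open>0 powr a = 0\<close> for every \<open>a\<close>.\<close>

lemma iterated_integral_N_w:
  assumes "q > -1" "w \<ge> 0"
  shows "(integral_from_0 ^^ m) (\<lambda>w. w powr q * N_Konhauser \<upsilon> s p q t w) w =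
       w powr (q + real m) * N_Konhauser \<upsilon> s p (q + real m) t w"
  using assms(2)
proof (induction m arbitrary: w)
  case (Suc m)
  have "integral {0..w} ((integral_from_0 ^^ m) (\<lambda>w. w powr q * N_Konhauser \<upsilon> s p q t w)) =
      integral {0..w} (\<lambda>w. w powr (q + real m) * N_Konhauser \<upsilon> s p (q + real m) t w)"
    by (rule integral_cong) (simp add: Suc.IH)
  also have "\<dots> = w powr (q + real m + 1) * N_Konhauser \<upsilon> s p (q + real m + 1) t w"
    using assms(1) Suc.prems by (intro integral_powr_N_w) auto
  finally show ?case
    using integral_from_0_def[of "(integral_from_0 ^^ m) (\<lambda>w. w powr q * N_Konhauser \<upsilon> s p q t w)" w]
    by (simp add: add_ac)
qed simp

lemma iterated_deriv_Konhauser_operator: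
  assumes "p - real s - 1 > 0" "\<upsilon> \<ge> 1" "q > -1" "w > 0"
  shows "(deriv ^^ \<upsilon>) (\<lambda>w. w powr (q + 1) * deriv (\<lambda>w. N_Konhauser \<upsilon> s p q t w) w) w =
       - real s * real \<upsilon> * (p - real s - 1) * t * w powr q * N_Konhauser \<upsilon> (s - 1) (p - 2) q t w"
proof -
  have "(deriv ^^ \<upsilon>) (\<lambda>w. w powr (q + 1) * deriv (\<lambda>w. N_Konhauser \<upsilon> s p q t w) w) w =
      - real s * real \<upsilon> * (p - real s - 1) * t *
      (w powr (q + real \<upsilon> - real \<upsilon>) * N_Konhauser \<upsilon> (s - 1) (p - 2) (q + real \<upsilon> - real \<upsilon>) t w)"
  proof (rule iterated_deriv_N_w)
    fix x :: real assume x: "x > 0"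
    have "x powr (q + real \<upsilon>) = x powr (q + 1 + real (\<upsilon> - 1))" using assms(2) by (simp add: of_nat_diff)
    also have "\<dots> = x powr (q + 1) * x ^ (\<upsilon> - 1)" by (simp only: powr_add powr_realpow[OF x])
    finally show "x powr (q + 1) * deriv (\<lambda>w. N_Konhauser \<upsilon> s p q t w) x =
        - real s * real \<upsilon> * (p - real s - 1) * t *
        (x powr (q + real \<upsilon>) * N_Konhauser \<upsilon> (s - 1) (p - 2) (q + real \<upsilon>) t x)"
      unfolding deriv_N_w[OF assms(1,2)] by (simp add: mult_ac)
  qed (use assms in auto)
  then show ?thesis by (simp add: mult.assoc)
qed

section \<open>The recurrence relations\<close>

theorem theorem22:
  fixes \<upsilon> s :: nat and p q :: real
  assumes "\<upsilon> \<ge> 1" and "q > -1" and "real s < (p - 1) / 2"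
  shows
    "(\<forall>t w. t * deriv (\<lambda>t. N_Konhauser \<upsilon> s p q t w) t = real s * (N_Konhauser \<upsilon> s p q t w + N_Konhauser \<upsilon> (s - 1) (p - 1) q t w)) \<and>
    (\<forall>t w. deriv (\<lambda>t. N_Konhauser \<upsilon> s p q t w) t =
       real s * (real s + 1 - p) * w ^ \<upsilon> * N_Konhauser \<upsilon> (s - 1) (p - 2) (q + real \<upsilon>) t w
       - real s * (real s - 1) * N_Konhauser \<upsilon> (s - 2) (p - 2) q t w
       + real s * (p - 2 * real s) * N_Konhauser \<upsilon> (s - 1) (p - 1) q t w) \<and>
    (\<forall>(m::nat) t w. real m \<le> p - 2 * real s - 1 \<and> t > 0 \<longrightarrow>
       (deriv ^^ m) (\<lambda>t. t powr (real s - p + real m) * N_Konhauser \<upsilon> s p q t w) t =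
       (-1) ^ m * Gamma (p - real s) / Gamma (p - real m - real s) *
       t powr (real s - p) * N_Konhauser \<upsilon> s (p - real m) q t w) \<and>
    (\<forall>(m::nat) t w. real m \<le> q \<and> w > 0 \<longrightarrow>
       (deriv ^^ m) (\<lambda>w. w powr q * N_Konhauser \<upsilon> s p q t w) w =
       w powr (q - real m) * N_Konhauser \<upsilon> s p (q - real m) t w) \<and>
    (\<forall>(m::nat) t w. t > 0 \<longrightarrow>
       (finite_part_integral_from_0 ^^ m) (\<lambda>t. t powr (real s - p - real m) * N_Konhauser \<upsilon> s p q t w) t =
       (-1) ^ m * Gamma (p - real s) / Gamma (p - real s + real m) *
       t powr (real s - p) * N_Konhauser \<upsilon> s (p + real m) q t w) \<and>
    (\<forall>(m::nat) t w. w > 0 \<longrightarrow>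
       (integral_from_0 ^^ m) (\<lambda>w. w powr q * N_Konhauser \<upsilon> s p q t w) w =
       w powr (q + real m) * N_Konhauser \<upsilon> s p (q + real m) t w) \<and>
    (\<forall>t w. w > 0 \<longrightarrow>
       (deriv ^^ \<upsilon>) (\<lambda>w. w powr (q + 1) * deriv (\<lambda>w. N_Konhauser \<upsilon> s p q t w) w) w =
       - real s * real \<upsilon> * (p - real s - 1) * t * w powr q * N_Konhauser \<upsilon> (s - 1) (p - 2) q t w) \<and>
    (\<forall>t w. w > 0 \<longrightarrow>
       (deriv ^^ \<upsilon>) (\<lambda>w. w powr (q + 1) * deriv (\<lambda>w. N_Konhauser \<upsilon> s p q t w) w) w =
       w powr (q + 1) * deriv (\<lambda>w. N_Konhauser \<upsilon> s p q t w) w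
       - real s * real \<upsilon> * w powr q * (N_Konhauser \<upsilon> s p q t w + N_Konhauser \<upsilon> (s - 1) (p - 1) q t w)) \<and>
    (\<forall>t w. w * deriv (\<lambda>w. N_Konhauser \<upsilon> s p q t w) w =
       real s * real \<upsilon> * (N_Konhauser \<upsilon> s p q t w + N_Konhauser \<upsilon> (s - 1) (p - 1) q t w
         - (p - real s - 1) * t * N_Konhauser \<upsilon> (s - 1) (p - 2) q t w)) \<and>
    (\<forall>t w. deriv (\<lambda>w. N_Konhauser \<upsilon> s p q t w) w =
       - real s * real \<upsilon> * (p - real s - 1) * t * w ^ (\<upsilon> - 1) *
       N_Konhauser \<upsilon> (s - 1) (p - 2) (q + real \<upsilon>) t w) \<and>
    (s \<ge> 2 \<longrightarrow> (\<forall>t w.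
       N_Konhauser \<upsilon> s p q t w + (real s - 1) * t * N_Konhauser \<upsilon> (s - 2) (p - 2) q t w =
       ((p - 2 * real s) * t - 1) * N_Konhauser \<upsilon> (s - 1) (p - 1) q t w
       - (p - real s - 1) * t * w ^ \<upsilon> * N_Konhauser \<upsilon> (s - 1) (p - 2) (q + real \<upsilon>) t w)) \<and>
    (s \<ge> 1 \<longrightarrow> (\<forall>t w.
       (p - real s - 1) * t *
         (N_Konhauser \<upsilon> (s - 1) (p - 2) q t w - w ^ \<upsilon> * N_Konhauser \<upsilon> (s - 1) (p - 2) (q + real \<upsilon>) t w) =
       N_Konhauser \<upsilon> s p q t w + N_Konhauser \<upsilon> (s - 1) (p - 1) q t w))"
proof -
  have pos2: "p - 2 * real s > 1" and pos1: "p - real s - 1 > 0" using assms(3) by simp_all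
  note w_deriv_w = times_deriv_N_w[OF pos1]
  note deriv_w = deriv_N_w[OF pos1 assms(1)]
  show ?thesis
  proof (intro conjI allI impI; (elim conjE)?)
    fix t w
    show "t * deriv (\<lambda>t. N_Konhauser \<upsilon> s p q t w) t =
        real s * (N_Konhauser \<upsilon> s p q t w + N_Konhauser \<upsilon> (s - 1) (p - 1) q t w)"
      by (rule times_deriv_N_t)
  next
    fix t w
    show "deriv (\<lambda>t. N_Konhauser \<upsilon> s p q t w) t =
       real s * (real s + 1 - p) * w ^ \<upsilon> * N_Konhauser \<upsilon> (s - 1) (p - 2) (q + real \<upsilon>) t w
       - real s * (real s - 1) * N_Konhauser \<upsilon> (s - 2) (p - 2) q t w
       + real s * (p - 2 * real s) * N_Konhauser \<upsilon> (s - 1) (p - 1) q t w"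
      by (rule deriv_N_t_lower[OF pos2])
  next
    fix m :: nat and t w :: real assume "real m \<le> p - 2 * real s - 1" "t > 0"
    then show "(deriv ^^ m) (\<lambda>t. t powr (real s - p + real m) * N_Konhauser \<upsilon> s p q t w) t =
       (-1) ^ m * Gamma (p - real s) / Gamma (p - real m - real s) *
       t powr (real s - p) * N_Konhauser \<upsilon> s (p - real m) q t w"
      by (intro iterated_deriv_N_t) auto
  next
    fix m :: nat and t w :: real assume "real m \<le> q" "w > 0"
    then show "(deriv ^^ m) (\<lambda>w. w powr q * N_Konhauser \<upsilon> s p q t w) w =
       w powr (q - real m) * N_Konhauser \<upsilon> s p (q - real m) t w"
      by (subst iterated_deriv_N_w[where c = 1]) auto
  next
    fix m :: nat and t w :: real assume "t > 0"
    then show "(finite_part_integral_from_0 ^^ m) (\<lambda>t. t powr (real s - p - real m) * N_Konhauser \<upsilon> s p q t w) t =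
       (-1) ^ m * Gamma (p - real s) / Gamma (p - real s + real m) *
       t powr (real s - p) * N_Konhauser \<upsilon> s (p + real m) q t w"
      using pos2 by (intro iterated_finite_part_integral_N_t) auto
  next
    fix m :: nat and t w :: real assume "w > 0"
    then show "(integral_from_0 ^^ m) (\<lambda>w. w powr q * N_Konhauser \<upsilon> s p q t w) w =
       w powr (q + real m) * N_Konhauser \<upsilon> s p (q + real m) t w"
      using assms(2) by (intro iterated_integral_N_w) auto
  next
    fix t w :: real assume "w > 0"
    then show "(deriv ^^ \<upsilon>) (\<lambda>w. w powr (q + 1) * deriv (\<lambda>w. N_Konhauser \<upsilon> s p q t w) w) w =
       - real s * real \<upsilon> * (p - real s - 1) * t * w powr q * N_Konhauser \<upsilon> (s - 1) (p - 2) q t w"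
      by (rule iterated_deriv_Konhauser_operator[OF pos1 assms(1,2)])
  next
    fix t w :: real assume w: "w > 0"
    have "w powr (q + 1) * deriv (\<lambda>w. N_Konhauser \<upsilon> s p q t w) w =
        w powr q * (w * deriv (\<lambda>w. N_Konhauser \<upsilon> s p q t w) w)"
      using w by (simp add: powr_add)
    also have "\<dots> = real s * real \<upsilon> * w powr q * (N_Konhauser \<upsilon> s p q t w + N_Konhauser \<upsilon> (s - 1) (p - 1) q t w)
        - real s * real \<upsilon> * (p - real s - 1) * t * w powr q * N_Konhauser \<upsilon> (s - 1) (p - 2) q t w"
      unfolding w_deriv_w by (simp add: algebra_simps)
    finally show "(deriv ^^ \<upsilon>) (\<lambda>w. w powr (q + 1) * deriv (\<lambda>w. N_Konhauser \<upsilon> s p q t w) w) w =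
       w powr (q + 1) * deriv (\<lambda>w. N_Konhauser \<upsilon> s p q t w) w
       - real s * real \<upsilon> * w powr q * (N_Konhauser \<upsilon> s p q t w + N_Konhauser \<upsilon> (s - 1) (p - 1) q t w)"
      unfolding iterated_deriv_Konhauser_operator[OF pos1 assms(1,2) w] by simp
  next
    fix t w
    show "w * deriv (\<lambda>w. N_Konhauser \<upsilon> s p q t w) w =
       real s * real \<upsilon> * (N_Konhauser \<upsilon> s p q t w + N_Konhauser \<upsilon> (s - 1) (p - 1) q t w
         - (p - real s - 1) * t * N_Konhauser \<upsilon> (s - 1) (p - 2) q t w)"
      by (rule w_deriv_w)
  next
    fix t w
    show "deriv (\<lambda>w. N_Konhauser \<upsilon> s p q t w) w =
       - real s * real \<upsilon> * (p - real s - 1) * t * w ^ (\<upsilon> - 1) *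
       N_Konhauser \<upsilon> (s - 1) (p - 2) (q + real \<upsilon>) t w"
      by (rule deriv_w)
  next
    \<comment> \<open>Multiply the formula for $D_t N$ by $t$, compare with the one for $t D_t N$, and divide by $s$.\<close>
    fix t w assume "s \<ge> 2"
    then have "real s \<noteq> 0" by simp
    moreover have "real s * (N_Konhauser \<upsilon> s p q t w + (real s - 1) * t * N_Konhauser \<upsilon> (s - 2) (p - 2) q t w) =
       real s * (((p - 2 * real s) * t - 1) * N_Konhauser \<upsilon> (s - 1) (p - 1) q t w
       - (p - real s - 1) * t * w ^ \<upsilon> * N_Konhauser \<upsilon> (s - 1) (p - 2) (q + real \<upsilon>) t w)"
      using times_deriv_N_t[of t \<upsilon> s p q w] unfolding deriv_N_t_lower[OF pos2]
      by (simp add: algebra_simps)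
    ultimately show "N_Konhauser \<upsilon> s p q t w + (real s - 1) * t * N_Konhauser \<upsilon> (s - 2) (p - 2) q t w =
       ((p - 2 * real s) * t - 1) * N_Konhauser \<upsilon> (s - 1) (p - 1) q t w
       - (p - real s - 1) * t * w ^ \<upsilon> * N_Konhauser \<upsilon> (s - 1) (p - 2) (q + real \<upsilon>) t w"
      by (simp only: mult_cancel_left) simp
  next
    \<comment> \<open>Multiply the formula for $D_w N$ by $w$, compare with the one for $w D_w N$, and divide by $s \upsilon$.\<close>
    fix t w :: real assume "s \<ge> 1"
    then have nz: "real s * real \<upsilon> \<noteq> 0" using assms(1) by simp
    have "w * w ^ (\<upsilon> - 1) = w ^ \<upsilon>" using assms(1) by (cases \<upsilon>) auto
    then have "w * (- real s * real \<upsilon> * (p - real s - 1) * t * w ^ (\<upsilon> - 1) *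
         N_Konhauser \<upsilon> (s - 1) (p - 2) (q + real \<upsilon>) t w) =
        real s * real \<upsilon> * (- ((p - real s - 1) * t * w ^ \<upsilon> * N_Konhauser \<upsilon> (s - 1) (p - 2) (q + real \<upsilon>) t w))"
      by (simp add: mult_ac)
    with w_deriv_w[of w \<upsilon> q t] have "real s * real \<upsilon> *
        (- ((p - real s - 1) * t * w ^ \<upsilon> * N_Konhauser \<upsilon> (s - 1) (p - 2) (q + real \<upsilon>) t w)) =
       real s * real \<upsilon> * (N_Konhauser \<upsilon> s p q t w + N_Konhauser \<upsilon> (s - 1) (p - 1) q t w
         - (p - real s - 1) * t * N_Konhauser \<upsilon> (s - 1) (p - 2) q t w)"
      unfolding deriv_w by simp
    then have "- ((p - real s - 1) * t * w ^ \<upsilon> * N_Konhauser \<upsilon> (s - 1) (p - 2) (q + real \<upsilon>) t w) =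
       N_Konhauser \<upsilon> s p q t w + N_Konhauser \<upsilon> (s - 1) (p - 1) q t w
         - (p - real s - 1) * t * N_Konhauser \<upsilon> (s - 1) (p - 2) q t w"
      unfolding mult_cancel_left using nz by blast
    then show "(p - real s - 1) * t *
         (N_Konhauser \<upsilon> (s - 1) (p - 2) q t w - w ^ \<upsilon> * N_Konhauser \<upsilon> (s - 1) (p - 2) (q + real \<upsilon>) t w) =
       N_Konhauser \<upsilon> s p q t w + N_Konhauser \<upsilon> (s - 1) (p - 1) q t w"
      by (simp add: algebra_simps)
  qed
qed

end
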